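(* There is a constant $C$ such that every program $P\in\mathcal P_2^n$ has at most $C\times 1.23651^n$ stable models, where $n$ is the number of atoms of $P$.
   Context: A clause is $p\leftarrow B$ (definite) or $\leftarrow B$ (a constraint), where $p$ is an atom and $B$ is a finite set of literals (atoms $a$ or negated atoms $\mathrm{not}(a)$). A propositional logic program is a finite set of clauses. $\mathcal P_2^n$ is the class of programs $P$ such that every clause of $P$ is definite, has at most 2 literals counting the head, and has no positive atoms in its body (purely negative), and $P$ contains no pair of dual clauses $a\leftarrow\mathrm{not}(b)$ and $b\leftarrow\mathrm{not}(a)$. $M\subseteq\mathit{At}(P)$ is a stable model of $P$ if $M$ is the least model of the Gelfond–Lifschitz reduct $P^M$, obtained by deleting every clause with some $\mathrm{not}(a)$, $a\in M$, in its body and deleting negated literals from the remaining clauses. *)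

theory Defs
  imports Complex_Main
begin

datatype 'a literal = Pos 'a | Neg 'a

datatype 'a clause =
    Definite 'a "'a literal set"
  | Constraint "'a literal set"

primrec body :: "'a clause \<Rightarrow> 'a literal set" where
  "body (Definite p B) = B"
| "body (Constraint B) = B"

primrec is_definite :: "'a clause \<Rightarrow> bool" where
  "is_definite (Definite p B) = True"
| "is_definite (Constraint B) = False"

text \<open>Number of literals of a clause, its head included.\<close>

primrec num_literals :: "'a clause \<Rightarrow> nat" where
  "num_literals (Definite p B) = Suc (card B)"
| "num_literals (Constraint B) = card B"

primrec atom_of :: "'a literal \<Rightarrow> 'a" where
  "atom_of (Pos a) = a"
| "atom_of (Neg a) = a"

primrec clause_atoms :: "'a clause \<Rightarrow> 'a set" where
  "clause_atoms (Definite p B) = insert p (atom_of ` B)"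
| "clause_atoms (Constraint B) = atom_of ` B"

definition At :: "'a clause set \<Rightarrow> 'a set" where
  "At P = (\<Union>c\<in>P. clause_atoms c)"

definition logic_program :: "'a clause set \<Rightarrow> bool" where
  "logic_program P \<longleftrightarrow> finite P \<and> (\<forall>c\<in>P. finite (body c))"

primrec sat_literal :: "'a set \<Rightarrow> 'a literal \<Rightarrow> bool" where
  "sat_literal M (Pos a) \<longleftrightarrow> a \<in> M"
| "sat_literal M (Neg a) \<longleftrightarrow> a \<notin> M"

primrec sat_clause :: "'a set \<Rightarrow> 'a clause \<Rightarrow> bool" where
  "sat_clause M (Definite p B) \<longleftrightarrow> ((\<forall>l\<in>B. sat_literal M l) \<longrightarrow> p \<in> M)"
| "sat_clause M (Constraint B) \<longleftrightarrow> \<not> (\<forall>l\<in>B. sat_literal M l)"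

definition model :: "'a clause set \<Rightarrow> 'a set \<Rightarrow> bool" where
  "model P M \<longleftrightarrow> (\<forall>c\<in>P. sat_clause M c)"

definition least_model :: "'a clause set \<Rightarrow> 'a set \<Rightarrow> bool" where
  "least_model P M \<longleftrightarrow> model P M \<and> (\<forall>N. model P N \<longrightarrow> M \<subseteq> N)"

primrec delete_negated :: "'a clause \<Rightarrow> 'a clause" where
  "delete_negated (Definite p B) = Definite p (B - range Neg)"
| "delete_negated (Constraint B) = Constraint (B - range Neg)"

text \<open>The Gelfond-Lifschitz reduct of \<open>P\<close> with respect to \<open>M\<close>.\<close>

definition reduct :: "'a clause set \<Rightarrow> 'a set \<Rightarrow> 'a clause set" where
  "reduct P M = delete_negated ` {c \<in> P. \<not> (\<exists>a\<in>M. Neg a \<in> body c)}"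

definition stable_model :: "'a clause set \<Rightarrow> 'a set \<Rightarrow> bool" where
  "stable_model P M \<longleftrightarrow> M \<subseteq> At P \<and> least_model (reduct P M) M"

definition purely_negative :: "'a clause \<Rightarrow> bool" where
  "purely_negative c \<longleftrightarrow> (\<forall>a. Pos a \<notin> body c)"

text \<open>
  A pair of dual clauses consists of two different clauses, so a single clause
  \<open>a \<leftarrow> not(a)\<close> is not excluded.
\<close>

definition has_dual_pair :: "'a clause set \<Rightarrow> bool" where
  "has_dual_pair P \<longleftrightarrow>
     (\<exists>a b. a \<noteq> b \<and> Definite a {Neg b} \<in> P \<and> Definite b {Neg a} \<in> P)"

text \<open>The class \<open>\<P>\<^sub>2\<^sup>n\<close>; the parameter \<open>n\<close> is the number of atoms occurring in the program.\<close>

definition P2 :: "nat \<Rightarrow> 'a clause set set" where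
  "P2 n = {P. logic_program P \<and> card (At P) = n \<and>
     (\<forall>c\<in>P. is_definite c \<and> num_literals c \<le> 2 \<and> purely_negative c) \<and>
     \<not> has_dual_pair P}"

lemma finite_At: "logic_program P \<Longrightarrow> finite (At P)"
proof -
  assume P: "logic_program P"
  have "finite (clause_atoms c)" if "c \<in> P" for c
    using P that by (cases c) (force simp: logic_program_def)+
  then show ?thesis using P by (auto simp: At_def logic_program_def)
qed

text \<open>Hence \<open>card\<close> really counts the stable models of a program.\<close>

lemma finite_stable_models: "logic_program P \<Longrightarrow> finite {M. stable_model P M}"
  by (rule finite_subset[where B = "Pow (At P)"]) (auto simp: stable_model_def finite_At)

end

theory Submission imports Defs begin

text \<open>
  For a purely negative program with at most one literal per body, call an atom false if it lies
  outside the stable model \<open>M\<close>. Drawing an edge \<open>b \<rightarrow> a\<close> for each clause \<open>a \<leftarrow> not(b)\<close>, an atom is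
  false iff it is no fact and has no false in-neighbour: the false atoms form a kernel of an
  oriented graph, the absence of dual clauses excluding 2-cycles. Kernels restrict well to
  induced subgraphs: if a kernel contains \<open>v\<close>, delete the closed neighbourhood of \<open>v\<close>; if it
  avoids \<open>v\<close>, delete \<open>v\<close>. One inducts on the number \<open>n\<close> of vertices, where a branching that deletes
  \<open>s\<^sub>1, \<dots>, s\<^sub>k\<close> vertices is admissible if \<open>\<Sum> \<gamma> ^ (- s\<^sub>i) \<le> 1\<close>; the constant \<open>\<gamma>\<close> is the root of
  \<open>\<gamma> ^ 5 = \<gamma> ^ 3 + 1\<close>, rounded up, that is, the branching \<open>(2, 5)\<close> is tight.

  A vertex of in-degree 0 lies in every kernel, and in-degree 1 allows a branching \<open>(3, 4)\<close>.
  If \<open>p\<close> has the only out-neighbour \<open>v\<close> and \<open>v\<close> has degree at least 4, then \<open>(2, 5)\<close> applies, because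
  outside of \<open>v\<close> the vertex \<open>p\<close> is a sink and thus determined by the rest. Otherwise the vertices of
  out-degree 1 are closed under out-neighbours, and the count is at most the product of the bounds
  for them and for the rest. So all degrees are at least 4; in-degree 2 yields \<open>(5, 5, 6)\<close>. If all
  in-degrees are at least 3, either some degree is at least 7, which yields \<open>(1, 8)\<close>, or the graph is
  3-regular in both directions, which yields \<open>(7, 7, 7, 7)\<close>.
\<close>

section \<open>Kernels of oriented graphs\<close>

locale oriented_graph =
  fixes E :: "'a \<Rightarrow> 'a \<Rightarrow> bool"
  assumes asym: "E a b \<Longrightarrow> \<not> E b a"
begin

lemma irrefl: "\<not> E a a"
  using asym by blast

definition kernels :: "'a set \<Rightarrow> 'a set set" where
  "kernels V = {K. K \<subseteq> V \<and> (\<forall>a\<in>V. a \<in> K \<longleftrightarrow> \<not> (\<exists>b\<in>K. E b a))}"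

text \<open>Not cut down to a vertex set, so one neighbourhood serves every induced
  subgraph.\<close>

definition nbh :: "'a set \<Rightarrow> 'a set" where
  "nbh F = F \<union> {a. \<exists>b\<in>F. E a b \<or> E b a}"

lemma kernels_subset: "K \<in> kernels V \<Longrightarrow> K \<subseteq> V"
  by (simp add: kernels_def)

lemma kernels_iff: "K \<in> kernels V \<Longrightarrow> a \<in> V \<Longrightarrow> a \<in> K \<longleftrightarrow> \<not> (\<exists>b\<in>K. E b a)"
  by (simp add: kernels_def)

lemma kernels_indep: "K \<in> kernels V \<Longrightarrow> a \<in> K \<Longrightarrow> b \<in> K \<Longrightarrow> \<not> E a b"
  using kernels_iff kernels_subset by blast

lemma finite_kernels: "finite V \<Longrightarrow> finite (kernels V)"
  by (rule finite_subset[where B = "Pow V"]) (auto simp: kernels_def)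

lemma kernels_empty: "kernels {} = {{}}"
  by (auto simp: kernels_def)

text \<open>No vertex of \<open>V - R\<close> is dominated from \<open>K \<inter> R\<close>, so its
  dominators survive the deletion.\<close>

lemma kernels_Diff:
  assumes "K \<in> kernels V" "\<And>a b. b \<in> K \<Longrightarrow> b \<in> R \<Longrightarrow> a \<in> V \<Longrightarrow> E b a \<Longrightarrow> a \<in> R"
  shows "K - R \<in> kernels (V - R)"
proof -
  have "a \<in> K - R \<longleftrightarrow> \<not> (\<exists>b\<in>K - R. E b a)" if "a \<in> V - R" for a
    using kernels_iff[OF assms(1), of a] assms(2) that by blast
  then show ?thesis using kernels_subset[OF assms(1)] by (auto simp: kernels_def)
qed

lemma card_le_kernels_Diff:
  assumes "finite V" "A \<subseteq> kernels V" "inj_on (\<lambda>K. K - R) A"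
    and "\<And>K a b. K \<in> A \<Longrightarrow> b \<in> K \<Longrightarrow> b \<in> R \<Longrightarrow> a \<in> V \<Longrightarrow> E b a \<Longrightarrow> a \<in> R"
  shows "card A \<le> card (kernels (V - R))"
proof (rule card_inj_on_le[OF assms(3)])
  show "(\<lambda>K. K - R) ` A \<subseteq> kernels (V - R)"
    using assms(2,4) by (intro image_subsetI kernels_Diff) blast+
qed (simp add: finite_kernels assms(1))

definition branch :: "'a set \<Rightarrow> 'a set \<Rightarrow> 'a set \<Rightarrow> 'a set set" where
  "branch V F X = {K \<in> kernels V. F \<subseteq> K \<and> K \<inter> X = {}}"

text \<open>By independence such a kernel meets the deleted set exactly in \<open>F\<close>, so the
  remainder determines it.\<close>

lemma card_branch_le:
  assumes "finite V"
  shows "card (branch V F X) \<le> card (kernels (V - (nbh F \<union> X)))"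
proof (rule card_le_kernels_Diff[OF assms])
  show sub: "branch V F X \<subseteq> kernels V" by (auto simp: branch_def)
  have *: "K \<inter> (nbh F \<union> X) = F" if "K \<in> branch V F X" for K
    using that kernels_indep[of K V] by (fastforce simp: branch_def nbh_def)
  show "inj_on (\<lambda>K. K - (nbh F \<union> X)) (branch V F X)"
    by (rule inj_onI) (metis * Int_Diff_Un)
  show "a \<in> nbh F \<union> X"
    if "K \<in> branch V F X" "b \<in> K" "b \<in> nbh F \<union> X" "a \<in> V" "E b a" for K a b
    using *[OF that(1)] that(2-) by (auto simp: nbh_def)
qed

text \<open>A kernel is determined by its part \<open>L\<close> outside of \<open>T\<close> and by its part inside of \<open>T\<close>, which is a
  kernel of the subgraph of the vertices of \<open>T\<close> that are not dominated by \<open>L\<close>.\<close>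

lemma card_kernels_out_closed:
  fixes B :: real
  assumes fin: "finite V" and T: "T \<subseteq> V"
    and closed: "\<And>a b. a \<in> T \<Longrightarrow> b \<in> V \<Longrightarrow> E a b \<Longrightarrow> b \<in> T"
    and bound: "\<And>W. W \<subseteq> T \<Longrightarrow> real (card (kernels W)) \<le> B"
  shows "real (card (kernels V)) \<le> real (card (kernels (V - T))) * B"
proof -
  define D where "D L = {a. \<exists>b\<in>L. E b a}" for L
  let ?S = "Sigma (kernels (V - T)) (\<lambda>L. kernels (T - D L))"
  have finT: "finite (T - D L)" for L using fin T by (meson finite_Diff finite_subset)
  have "card (kernels V) \<le> card ?S"
  proof (rule card_inj_on_le)
    show "inj_on (\<lambda>K. (K - T, K \<inter> T)) (kernels V)"
      by (rule inj_onI) (metis Int_Diff_Un Pair_inject)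
    have "K \<inter> T \<in> kernels (T - D (K - T))" if K: "K \<in> kernels V" for K
    proof -
      have "a \<in> K \<inter> T \<longleftrightarrow> \<not> (\<exists>b\<in>K \<inter> T. E b a)" if "a \<in> T - D (K - T)" for a
        using kernels_iff[OF K, of a] that T by (auto simp: D_def)
      moreover have "K \<inter> T \<subseteq> T - D (K - T)"
        using kernels_indep[OF K] by (auto simp: D_def)
      ultimately show ?thesis by (auto simp: kernels_def)
    qed
    moreover have "K - T \<in> kernels (V - T)" if "K \<in> kernels V" for K
      using kernels_Diff[OF that] closed by blast
    ultimately show "(\<lambda>K. (K - T, K \<inter> T)) ` kernels V \<subseteq> ?S" by auto
    show "finite ?S" using fin finT by (intro finite_SigmaI finite_kernels) auto
  qed
  also have "card ?S = (\<Sum>L\<in>kernels (V - T). card (kernels (T - D L)))"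
    using fin finT by (intro card_SigmaI) (auto simp: finite_kernels)
  finally have "real (card (kernels V)) \<le> (\<Sum>L\<in>kernels (V - T). real (card (kernels (T - D L))))"
    by (simp flip: of_nat_sum)
  also have "\<dots> \<le> (\<Sum>L\<in>kernels (V - T). B)"
    by (intro sum_mono bound) auto
  finally show ?thesis by simp
qed

end

section \<open>The induction step\<close>

abbreviation growth :: real ("\<gamma>") where "\<gamma> \<equiv> 1.23651"

locale kernel_induction = oriented_graph E for E :: "'a \<Rightarrow> 'a \<Rightarrow> bool" +
  fixes V :: "'a set"
  assumes fin: "finite V"
    and IH: "W \<subset> V \<Longrightarrow> real (card (kernels W)) \<le> \<gamma> ^ card W"
begin

definition ins :: "'a \<Rightarrow> 'a set" where "ins v = {u \<in> V. E u v}"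
definition outs :: "'a \<Rightarrow> 'a set" where "outs v = {u \<in> V. E v u}"
definition deg :: "'a \<Rightarrow> nat" where "deg v = card (ins v) + card (outs v)"

text \<open>The kernels in \<open>A\<close> are at most as many as the bound allows after deleting \<open>s\<close> vertices.\<close>

definition saves :: "'a set set \<Rightarrow> nat \<Rightarrow> bool" where
  "saves A s \<longleftrightarrow> real (card A) \<le> \<gamma> ^ card V / \<gamma> ^ s"

lemma finite_ins [simp]: "finite (ins v)" and finite_outs [simp]: "finite (outs v)"
  using fin by (auto simp: ins_def outs_def)

lemma savesI:
  assumes "card A \<le> card (kernels (V - R))" "0 < s" "s \<le> card (V \<inter> R)"
  shows "saves A s"
proof -
  \<comment> \<open>A positive \<open>s\<close> makes \<open>V - R\<close> a proper subset, as
    \<open>IH\<close> requires.\<close>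
  have "V \<inter> R \<noteq> {}" using assms by auto
  then have "real (card (kernels (V - R))) \<le> \<gamma> ^ card (V - R)" by (intro IH) auto
  also have "card (V - R) = card V - card (V \<inter> R)"
    using fin by (simp add: card_Diff_subset_Int)
  also have "\<gamma> ^ (card V - card (V \<inter> R)) \<le> \<gamma> ^ (card V - s)"
    using assms(3) by (intro power_increasing) auto
  also have "\<gamma> ^ (card V - s) = \<gamma> ^ card V / \<gamma> ^ s"
    using assms(3) card_mono[OF fin, of "V \<inter> R"] by (intro power_diff) auto
  finally show ?thesis using assms(1) by (simp add: saves_def)
qed

lemma saves_branch:
  assumes "0 < s" "s \<le> card (V \<inter> (nbh F \<union> X))"
  shows "saves (branch V F X) s"
  using savesI[OF card_branch_le[OF fin] assms] .

lemma card_nbh: "v \<in> V \<Longrightarrow> card (V \<inter> nbh {v}) = Suc (deg v)"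
proof -
  assume "v \<in> V"
  then have "V \<inter> nbh {v} = insert v (ins v \<union> outs v)" by (auto simp: nbh_def ins_def outs_def)
  moreover have "v \<notin> ins v \<union> outs v" "ins v \<inter> outs v = {}"
    using irrefl asym by (auto simp: ins_def outs_def)
  ultimately show ?thesis by (simp add: deg_def card_Un_disjoint)
qed

lemma saves_member:
  assumes "v \<in> V" "0 < s" "s \<le> Suc (deg v)"
  shows "saves (branch V {v} {}) s"
  using assms by (intro saves_branch) (auto simp: card_nbh)

lemma saves_empty: "saves {} s"
  by (simp add: saves_def)

lemma card_nbh_insert:
  assumes "v \<in> V" "w \<in> V" "w \<notin> nbh {v}" "nbh {v} \<union> {w} \<subseteq> R"
  shows "Suc (Suc (deg v)) \<le> card (V \<inter> R)"
proof -
  have "Suc (Suc (deg v)) = card (insert w (V \<inter> nbh {v}))"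
    using assms fin by (simp add: card_nbh)
  also have "\<dots> \<le> card (V \<inter> R)"
    using assms fin by (intro card_mono) auto
  finally show ?thesis .
qed

lemma finite_branch [simp]: "finite (branch V F X)"
  using finite_kernels[OF fin] by (simp add: branch_def)

lemma bound_saves2:
  assumes "kernels V \<subseteq> A \<union> B" "A \<subseteq> kernels V" "B \<subseteq> kernels V" "saves A s" "saves B t"
    and num: "1 / \<gamma> ^ s + 1 / \<gamma> ^ t \<le> 1"
  shows "real (card (kernels V)) \<le> \<gamma> ^ card V"
proof -
  have "kernels V = A \<union> B" using assms by auto
  then have "real (card (kernels V)) \<le> real (card A + card B)"
    by (simp only: card_Un_le of_nat_mono)
  also have "\<dots> \<le> \<gamma> ^ card V * (1 / \<gamma> ^ s + 1 / \<gamma> ^ t)"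
    using assms(4,5) by (simp add: saves_def distrib_left)
  also have "\<dots> \<le> \<gamma> ^ card V * 1" by (intro mult_left_mono num) auto
  finally show ?thesis by simp
qed

lemma bound_saves3:
  assumes "kernels V \<subseteq> A \<union> B \<union> C" "A \<subseteq> kernels V" "B \<subseteq> kernels V" "C \<subseteq> kernels V"
    and "saves A s" "saves B t" "saves C u"
    and num: "1 / \<gamma> ^ s + 1 / \<gamma> ^ t + 1 / \<gamma> ^ u \<le> 1"
  shows "real (card (kernels V)) \<le> \<gamma> ^ card V"
proof -
  have "kernels V = A \<union> B \<union> C" using assms by auto
  then have "card (kernels V) \<le> card A + card B + card C"
    by (metis add_le_mono1 card_Un_le le_trans)
  then have "real (card (kernels V)) \<le> real (card A) + real (card B) + real (card C)"
    by linarith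
  also have "\<dots> \<le> \<gamma> ^ card V * (1 / \<gamma> ^ s + 1 / \<gamma> ^ t + 1 / \<gamma> ^ u)"
    using assms(5-7) by (simp add: saves_def distrib_left)
  also have "\<dots> \<le> \<gamma> ^ card V * 1" by (intro mult_left_mono num) auto
  finally show ?thesis by simp
qed

lemma branch_subset: "branch V F X \<subseteq> kernels V"
  by (auto simp: branch_def)

lemma kernel_ins: "K \<in> kernels V \<Longrightarrow> v \<in> V \<Longrightarrow> v \<in> K \<longleftrightarrow> K \<inter> ins v = {}"
  using kernels_iff[of K V v] kernels_subset[of K V] by (auto simp: ins_def)

text \<open>Monotonicity bounds all subgraphs of \<open>T\<close> by
  \<open>\<gamma> ^ card T\<close>, and the exponents of the two factors add up to
  \<open>card V\<close>.\<close>

lemma bound_out_closed: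
  assumes "T \<subset> V" "T \<noteq> {}" "\<And>a. a \<in> T \<Longrightarrow> outs a \<subseteq> T"
  shows "real (card (kernels V)) \<le> \<gamma> ^ card V"
proof -
  have "real (card (kernels W)) \<le> \<gamma> ^ card T" if "W \<subseteq> T" for W
  proof -
    have "real (card (kernels W)) \<le> \<gamma> ^ card W" using that assms(1) by (intro IH) auto
    also have "\<dots> \<le> \<gamma> ^ card T"
      using that assms(1) fin by (intro power_increasing card_mono) (auto intro: finite_subset)
    finally show ?thesis .
  qed
  then have "real (card (kernels V)) \<le> real (card (kernels (V - T))) * \<gamma> ^ card T"
    using assms by (intro card_kernels_out_closed fin) (auto simp: outs_def)
  also have "\<dots> \<le> \<gamma> ^ card (V - T) * \<gamma> ^ card T"
    using assms by (intro mult_right_mono IH) auto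
  also have "\<dots> = \<gamma> ^ card V"
    using assms(1) fin card_mono[OF fin, of T]
    by (simp add: psubset_eq card_Diff_subset finite_subset[OF _ fin] flip: power_add)
  finally show ?thesis .
qed

section \<open>In-degree or out-degree at most 1\<close>

lemma bound_ins_0:
  assumes "v \<in> V" "ins v = {}"
  shows "real (card (kernels V)) \<le> \<gamma> ^ card V"
proof -
  have "kernels V = branch V {v} {}"
    using assms kernel_ins by (auto simp: branch_def)
  moreover have "saves (branch V {v} {}) 1" using assms by (intro saves_member) auto
  ultimately have "real (card (kernels V)) \<le> \<gamma> ^ card V / \<gamma>" by (simp add: saves_def)
  also have "\<dots> \<le> \<gamma> ^ card V" by (simp add: field_simps)
  finally show ?thesis .
qed

lemma bound_outs_0:
  assumes "v \<in> V" "outs v = {}" "ins v \<noteq> {}"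
  shows "real (card (kernels V)) \<le> \<gamma> ^ card V"
proof (rule bound_out_closed)
  show "{v} \<subset> V" using assms irrefl by (auto simp: ins_def)
qed (use assms in auto)

text \<open>A kernel contains exactly one of \<open>v\<close> and its only in-neighbour
  \<open>u\<close>.\<close>

lemma bound_ins_1:
  assumes nonempty: "\<And>v. v \<in> V \<Longrightarrow> ins v \<noteq> {} \<and> outs v \<noteq> {}"
    and v: "v \<in> V" and v1: "card (ins v) = 1"
  shows "real (card (kernels V)) \<le> \<gamma> ^ card V"
proof -
  obtain u where u: "ins v = {u}" using v1 card_1_singletonE by blast
  then have uV: "u \<in> V" "E u v" by (auto simp: ins_def)
  have pos: "card (ins w) \<ge> 1" "card (outs w) \<ge> 1" if "w \<in> V" for w
    using nonempty[OF that] by (simp_all add: Suc_le_eq card_gt_0_iff)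
  have num: "1 / \<gamma> ^ 4 + 1 / \<gamma> ^ 3 \<le> 1" by (simp add: power_divide field_simps)
  show ?thesis
  proof (cases "deg u \<ge> 3")
    case True
    show ?thesis
    proof (rule bound_saves2[OF _ branch_subset branch_subset _ _ num])
      show "kernels V \<subseteq> branch V {u} {} \<union> branch V {v} {}"
        using kernel_ins v u by (auto simp: branch_def)
      show "saves (branch V {u} {}) 4" using True uV by (intro saves_member) auto
      show "saves (branch V {v} {}) 3"
        using pos[OF v] v by (intro saves_member) (auto simp: deg_def)
    qed
  next
    case False
    \<comment> \<open>Now \<open>u\<close> has a single in-neighbour \<open>w\<close>: a kernel with
      \<open>v\<close> excludes \<open>u\<close> and hence contains \<open>w\<close>. An
      in-neighbour \<open>p\<close> of \<open>w\<close> is the fourth deleted vertex.\<close>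
    then have "card (ins u) = 1" using pos[OF uV(1)] by (simp add: deg_def)
    then obtain w where w: "ins u = {w}" using card_1_singletonE by blast
    then have wV: "w \<in> V" "E w u" by (auto simp: ins_def)
    obtain p where p: "p \<in> V" "E p w" using nonempty[OF wV(1)] by (auto simp: ins_def)
    show ?thesis
    proof (rule bound_saves2[OF _ branch_subset branch_subset _ _ num])
      show "kernels V \<subseteq> branch V {w, v} {} \<union> branch V {u} {}"
        using kernel_ins[OF _ v] kernel_ins[OF _ uV(1)] u w by (auto simp: branch_def)
      show "saves (branch V {u} {}) 3"
        using pos[OF uV(1)] uV by (intro saves_member) (auto simp: deg_def)
      show "saves (branch V {w, v} {}) 4"
      proof (cases "E v w")
        case True
        then have "branch V {w, v} {} = {}" using kernels_indep by (auto simp: branch_def)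
        then show ?thesis by (simp add: saves_empty)
      next
        case False
        have "w \<noteq> u" "w \<noteq> v" "u \<noteq> v" "p \<noteq> w" "p \<noteq> u" "p \<noteq> v"
          using False asym irrefl uV wV p by metis+
        then have "card {w, u, v, p} = 4" by simp
        moreover have "{w, u, v, p} \<subseteq> V \<inter> (nbh {w, v} \<union> {})"
          using v uV wV p by (auto simp: nbh_def)
        ultimately have "4 \<le> card (V \<inter> (nbh {w, v} \<union> {}))"
          using fin by (metis card_mono finite_Int)
        then show ?thesis by (intro saves_branch) auto
      qed
    qed
  qed
qed

lemma bound_outs_1:
  assumes p: "p \<in> V" and out: "outs p = {v}" and deg: "deg v \<ge> 4"
  shows "real (card (kernels V)) \<le> \<gamma> ^ card V"
proof -
  have v: "v \<in> V" "E p v" using out by (auto simp: outs_def)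
  have pv: "p \<noteq> v" "v \<notin> ins p" "p \<notin> ins p"
    using v irrefl asym by (auto simp: ins_def)
  have num: "1 / \<gamma> ^ 5 + 1 / \<gamma> ^ 2 \<le> 1" by (simp add: power_divide field_simps)
  show ?thesis
  proof (rule bound_saves2[OF _ branch_subset branch_subset _ _ num])
    show "kernels V \<subseteq> branch V {v} {} \<union> branch V {} {v}" by (auto simp: branch_def)
    show "saves (branch V {v} {}) 5" using v deg by (intro saves_member) auto
    show "saves (branch V {} {v}) 2"
    proof (rule savesI)
      show "card (branch V {} {v}) \<le> card (kernels (V - {v, p}))"
      proof (rule card_le_kernels_Diff[OF fin branch_subset])
        show "inj_on (\<lambda>K. K - {v, p}) (branch V {} {v})"
        proof (rule inj_onI)
          fix K L assume K: "K \<in> branch V {} {v}" and L: "L \<in> branch V {} {v}"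
            and eq: "K - {v, p} = L - {v, p}"
          \<comment> \<open>\<open>ins p\<close> misses both deleted vertices, so the rest of the
            kernel decides on \<open>p\<close>.\<close>
          have "K \<inter> ins p = L \<inter> ins p" using eq pv by blast
          then have "p \<in> K \<longleftrightarrow> p \<in> L" using kernel_ins[OF _ p] K L by (simp add: branch_def)
          then show "K = L" using eq K L by (auto simp: branch_def)
        qed
      qed (use out in \<open>auto simp: branch_def outs_def\<close>)
      show "2 \<le> card (V \<inter> {v, p})" using v p pv by (simp add: Int_absorb1)
    qed simp
  qed
qed

section \<open>In-degree 2\<close>

lemma bound_555_6:
  assumes "kernels V \<subseteq> A \<union> B \<union> C" "A \<subseteq> kernels V" "B \<subseteq> kernels V" "C \<subseteq> kernels V"
    and "saves A 5" "saves B 5" "saves C 6"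
  shows "real (card (kernels V)) \<le> \<gamma> ^ card V"
proof (rule bound_saves3[OF assms])
  \<comment> \<open>Three summands \<open>1 / \<gamma> ^ 5\<close> would exceed 1, hence the sixth
    vertex in one branch.\<close>
  show "1 / \<gamma> ^ 5 + 1 / \<gamma> ^ 5 + 1 / \<gamma> ^ 6 \<le> 1" by (simp add: power_divide field_simps)
qed

text \<open>Every kernel contains \<open>q\<close>, \<open>a\<close> or \<open>b\<close>, so a sixth
  vertex in any one branch suffices. A degree above 4 yields it; if \<open>a\<close> and
  \<open>b\<close> are not adjacent, the branch with \<open>b\<close> but without \<open>a\<close>
  deletes \<open>a\<close> on top of the closed neighbourhood of \<open>b\<close>.\<close>

lemma ins_2_cases:
  assumes deg: "\<And>v. v \<in> V \<Longrightarrow> deg v \<ge> 4"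
    and q: "q \<in> V" "ins q = {a, b}" "a \<noteq> b"
  shows "real (card (kernels V)) \<le> \<gamma> ^ card V \<or>
    deg q = 4 \<and> deg a = 4 \<and> deg b = 4 \<and> (E a b \<or> E b a)"
proof -
  have V: "a \<in> V" "b \<in> V" using q by (auto simp: ins_def)
  have s5: "saves (branch V {v} {}) 5" if "v \<in> V" for v
    using deg[OF that] that by (intro saves_member) auto
  have s6: "saves (branch V {v} {}) 6" if "v \<in> V" "deg v \<noteq> 4" for v
    using deg[OF that(1)] that by (intro saves_member) auto
  have cover: "kernels V \<subseteq> branch V {q} {} \<union> branch V {a} {} \<union> branch V {b} {a}"
    using kernel_ins[OF _ q(1)] q by (auto simp: branch_def)
  have "branch V {b} {a} \<subseteq> branch V {b} {}" by (auto simp: branch_def)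
  then have cover': "kernels V \<subseteq> branch V {q} {} \<union> branch V {a} {} \<union> branch V {b} {}"
    using cover by blast
  note bs = branch_subset
  consider "deg q \<noteq> 4" | "deg a \<noteq> 4" | "deg b \<noteq> 4" | "\<not> (E a b \<or> E b a)"
    | "deg q = 4 \<and> deg a = 4 \<and> deg b = 4 \<and> (E a b \<or> E b a)" by blast
  then show ?thesis
  proof cases
    case 1
    then show ?thesis
      using bound_555_6[OF _ bs bs bs s5[OF V(1)] s5[OF V(2)] s6[OF q(1)]] cover' by blast
  next
    case 2
    then show ?thesis
      using bound_555_6[OF _ bs bs bs s5[OF q(1)] s5[OF V(2)] s6[OF V(1)]] cover' by blast
  next
    case 3
    then show ?thesis
      using bound_555_6[OF _ bs bs bs s5[OF q(1)] s5[OF V(1)] s6[OF V(2)]] cover' by blast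
  next
    case 4
    have "Suc (Suc (deg b)) \<le> card (V \<inter> (nbh {b} \<union> {a}))"
      using 4 V q by (intro card_nbh_insert) (auto simp: nbh_def)
    then have "saves (branch V {b} {a}) 6"
      using deg[OF V(2)] by (intro saves_branch) auto
    then show ?thesis
      using bound_555_6[OF cover bs bs bs s5[OF q(1)] s5[OF V(1)]] by blast
  qed blast
qed

lemma card_2_obtain_other:
  assumes "card A = 2" "x \<in> A"
  obtains y where "A = {x, y}" "x \<noteq> y"
  using assms unfolding card_2_iff by (metis insertE insert_commute singletonD)

text \<open>In the case left over by \<open>ins_2_cases\<close>, let \<open>a \<rightarrow> b\<close> be the in-neighbours of \<open>q\<close>. The in-neighbours
  of \<open>b\<close> are \<open>a\<close> and some \<open>c\<close> with \<open>c \<rightarrow> a\<close>. So a kernel that contains \<open>b\<close> avoids \<open>c\<close>, and if it also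
  avoids \<open>a\<close>, it must contain the other in-neighbour \<open>f\<close> of \<open>a\<close>: a sixth vertex is deleted.\<close>

lemma bound_ins_2:
  assumes ge2: "\<And>v. v \<in> V \<Longrightarrow> card (ins v) \<ge> 2 \<and> card (outs v) \<ge> 2"
    and q: "q \<in> V" "card (ins q) = 2"
  shows "real (card (kernels V)) \<le> \<gamma> ^ card V"
proof (rule ccontr)
  assume neg: "\<not> ?thesis"
  have deg: "deg v \<ge> 4" if "v \<in> V" for v using ge2[OF that] by (simp add: deg_def)
  have two: "card (ins v) = 2" "card (outs v) = 2" if "v \<in> V" "deg v = 4" for v
    using ge2[OF that(1)] that(2) by (auto simp: deg_def)
  \<comment> \<open>The surviving case is symmetric in the two in-neighbours, so \<open>a\<close>
    may be the tail of their edge.\<close>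
  obtain a b where ab: "ins q = {a, b}" "a \<noteq> b" "E a b"
    using q(2) ins_2_cases[OF deg q(1)] neg unfolding card_2_iff by (metis insert_commute)
  have V: "a \<in> V" "b \<in> V" "E a q" "E b q" using ab by (auto simp: ins_def)
  have d: "deg q = 4" "deg a = 4" "deg b = 4"
    using ins_2_cases[OF deg q(1) ab(1,2)] neg by auto
  have "a \<in> ins b" using ab V by (simp add: ins_def)
  then obtain c where c: "ins b = {a, c}" "a \<noteq> c"
    using card_2_obtain_other[OF two(1)[OF V(2) d(3)]] by blast
  then have cV: "c \<in> V" "E c b" by (auto simp: ins_def)
  have neq: "q \<noteq> b" "c \<noteq> b" "c \<noteq> q" using V cV asym irrefl by metis+
  \<comment> \<open>Degree 4 leaves \<open>a\<close> no other out-neighbour, so the edge that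
    \<open>ins_2_cases\<close> gives between \<open>a\<close> and \<open>c\<close> starts at
    \<open>c\<close>.\<close>
  have "{b, q} \<subseteq> outs a" using ab V q by (auto simp: outs_def)
  then have "outs a = {b, q}"
    using two(2)[OF V(1) d(2)] neq by (intro card_seteq[symmetric]) auto
  then have "\<not> E a c" using cV neq by (auto simp: outs_def)
  then have "E c a" using ins_2_cases[OF deg V(2) c] neg by blast
  then have "c \<in> ins a" using cV by (simp add: ins_def)
  then obtain f where f: "ins a = {c, f}" "c \<noteq> f"
    using card_2_obtain_other[OF two(1)[OF V(1) d(2)]] by blast
  then have fV: "f \<in> V" "E f a" by (auto simp: ins_def)
  have fb: "f \<noteq> b" using fV ab asym by blast
  have cover: "kernels V \<subseteq> branch V {q} {} \<union> branch V {a} {} \<union> branch V {b, f} {}"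
    using kernel_ins[OF _ q(1)] kernel_ins[OF _ V(1)] kernel_ins[OF _ V(2)] ab c f
    by (auto simp: branch_def)
  have "saves (branch V {b, f} {}) 6"
  proof (cases "f \<in> nbh {b}")
    case True
    then have "branch V {b, f} {} = {}"
      using kernels_indep fb by (auto simp: branch_def nbh_def)
    then show ?thesis by (simp add: saves_empty)
  next
    case False
    have "Suc (Suc (deg b)) \<le> card (V \<inter> (nbh {b, f} \<union> {}))"
      using False V fV by (intro card_nbh_insert) (auto simp: nbh_def)
    then show ?thesis using d by (intro saves_branch) auto
  qed
  moreover have "saves (branch V {q} {}) 5" "saves (branch V {a} {}) 5"
    using q V d by (intro saves_member; simp)+
  ultimately show False
    using bound_555_6[OF cover branch_subset branch_subset branch_subset] neg by blast
qed

section \<open>In-degree at least 3\<close>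

lemma sum_ins_eq_sum_outs: "(\<Sum>v\<in>V. card (ins v)) = (\<Sum>v\<in>V. card (outs v))"
proof -
  have "(\<Sum>v\<in>V. card (ins v)) = (\<Sum>v\<in>V. \<Sum>u\<in>{u\<in>V. E u v}. 1)" by (simp add: ins_def)
  also have "\<dots> = (\<Sum>u\<in>V. \<Sum>v\<in>{v\<in>V. E u v}. 1)" by (rule sum.swap_restrict[OF fin fin])
  finally show ?thesis by (simp add: outs_def)
qed

lemma bound_ins_3:
  assumes ne: "V \<noteq> {}" and ge3: "\<And>v. v \<in> V \<Longrightarrow> card (ins v) \<ge> 3"
  shows "real (card (kernels V)) \<le> \<gamma> ^ card V"
proof (cases "\<exists>v\<in>V. deg v \<ge> 7")
  case True
  then obtain v where v: "v \<in> V" "deg v \<ge> 7" by blast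
  have num: "1 / \<gamma> ^ 8 + 1 / \<gamma> ^ 1 \<le> 1" by (simp add: power_divide field_simps)
  show ?thesis
  proof (rule bound_saves2[OF _ branch_subset branch_subset _ _ num])
    show "kernels V \<subseteq> branch V {v} {} \<union> branch V {} {v}" by (auto simp: branch_def)
    show "saves (branch V {v} {}) 8" using v by (intro saves_member) auto
    show "saves (branch V {} {v}) 1" using v by (intro saves_branch) (auto simp: nbh_def)
  qed
next
  case False
  then have le6: "card (ins v) + card (outs v) \<le> 6" if "v \<in> V" for v
    using that by (fastforce simp: deg_def)
  have out3: "card (outs v) \<le> 3" if "v \<in> V" for v using le6[OF that] ge3[OF that] by simp
  \<comment> \<open>In-degrees at least 3, out-degrees at most 3 and equal totals force equality
    everywhere.\<close>
  have "(\<Sum>v\<in>V. 3) \<le> (\<Sum>v\<in>V. card (ins v))" by (intro sum_mono ge3)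
  moreover have "(\<Sum>v\<in>V. card (outs v)) \<le> (\<Sum>v\<in>V. 3)" by (intro sum_mono out3)
  ultimately have sums: "(\<Sum>v\<in>V. 3) = (\<Sum>v\<in>V. card (ins v))"
      "(\<Sum>v\<in>V. card (outs v)) = (\<Sum>v\<in>V. 3)"
    using sum_ins_eq_sum_outs by linarith+
  have eq3: "card (ins v) = 3" "card (outs v) = 3" if "v \<in> V" for v
    using sum_mono_inv[OF sums(1) ge3 that fin] sum_mono_inv[OF sums(2) out3 that fin] by auto
  then have deg6: "deg v = 6" if "v \<in> V" for v using that by (simp add: deg_def)
  obtain v where v: "v \<in> V" using ne by blast
  let ?W = "insert v (ins v)"
  have "v \<notin> ins v" using irrefl by (simp add: ins_def)
  then have W: "?W \<subseteq> V" "card ?W = 4"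
    using v eq3(1)[OF v] by (simp_all add: card_insert_disjoint) (simp add: ins_def)
  \<comment> \<open>A kernel contains \<open>v\<close> or one of its three in-neighbours; each has
    degree 6 and deletes 7 vertices.\<close>
  have "kernels V = (\<Union>w\<in>?W. branch V {w} {})"
    using kernel_ins[OF _ v] by (auto simp: branch_def)
  then have "card (kernels V) \<le> (\<Sum>w\<in>?W. card (branch V {w} {}))"
    by (simp only:) (rule card_UN_le, simp)
  then have "real (card (kernels V)) \<le> (\<Sum>w\<in>?W. real (card (branch V {w} {})))"
    by (simp only: of_nat_mono flip: of_nat_sum)
  also have "\<dots> \<le> (\<Sum>w\<in>?W. \<gamma> ^ card V / \<gamma> ^ 7)"
    using saves_member[of _ 7] deg6 W(1) by (intro sum_mono) (auto simp: saves_def)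
  also have "\<dots> = \<gamma> ^ card V * (4 / \<gamma> ^ 7)" using W(2) by simp
  also have "\<dots> \<le> \<gamma> ^ card V * 1"
    by (intro mult_left_mono) (simp_all add: power_divide field_simps)
  finally show ?thesis by simp
qed

section \<open>The case distinction by degrees\<close>

lemma bound: "real (card (kernels V)) \<le> \<gamma> ^ card V"
proof (rule ccontr)
  assume neg: "\<not> ?thesis"
  have ne: "V \<noteq> {}" using neg by (auto simp: kernels_empty)
  have nonempty: "ins v \<noteq> {} \<and> outs v \<noteq> {}" if "v \<in> V" for v
    using bound_ins_0[OF that] bound_outs_0[OF that] neg by blast
  then have "card (ins v) \<ge> 1" if "v \<in> V" for v
    using that by (simp add: Suc_le_eq card_gt_0_iff)
  moreover have "card (ins v) \<noteq> 1" if "v \<in> V" for v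
    using bound_ins_1[OF nonempty that] neg by blast
  ultimately have ins2: "card (ins v) \<ge> 2" if "v \<in> V" for v
    using that by fastforce
  have outs1: "card (outs v) \<ge> 1" if "v \<in> V" for v
    using nonempty[OF that] by (simp add: Suc_le_eq card_gt_0_iff)
  define T where "T = {p \<in> V. card (outs p) = 1}"
  have closed: "outs p \<subseteq> T" if "p \<in> T" for p
  proof -
    have p: "p \<in> V" "card (outs p) = 1" using that by (simp_all add: T_def)
    obtain v where v: "outs p = {v}" using card_1_singletonE[OF p(2)] by blast
    then have vV: "v \<in> V" by (auto simp: outs_def)
    have "\<not> deg v \<ge> 4" using bound_outs_1[OF p(1) v] neg by blast
    then have "card (outs v) = 1" using ins2[OF vV] outs1[OF vV] by (simp add: deg_def)
    then show ?thesis using v vV by (simp add: T_def)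
  qed
  \<comment> \<open>Otherwise the out-degrees would sum to \<open>card V\<close>, the in-degrees to
    at least twice that.\<close>
  have "T \<noteq> V"
  proof
    assume "T = V"
    then have "(\<Sum>v\<in>V. card (outs v)) = (\<Sum>v\<in>V. 1)" by (intro sum.cong) (auto simp: T_def)
    moreover have "(\<Sum>v\<in>V. 2) \<le> (\<Sum>v\<in>V. card (ins v))" by (intro sum_mono ins2)
    ultimately show False using sum_ins_eq_sum_outs ne fin by (simp add: card_gt_0_iff)
  qed
  then have "T \<subset> V" by (auto simp: T_def)
  then have "T = {}" using bound_out_closed[OF _ _ closed] neg by blast
  then have ge2: "card (ins v) \<ge> 2 \<and> card (outs v) \<ge> 2" if "v \<in> V" for v
  proof -
    have "card (outs v) \<noteq> 1" using \<open>T = {}\<close> that by (auto simp: T_def)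
    then show ?thesis using ins2[OF that] outs1[OF that] by linarith
  qed
  then have "card (ins v) \<noteq> 2" if "v \<in> V" for v
    using bound_ins_2[OF ge2 that] neg by blast
  then have "card (ins v) \<ge> 3" if "v \<in> V" for v
    using ge2[OF that] that by fastforce
  then show False using bound_ins_3[OF ne] neg by blast
qed

end

theorem (in oriented_graph) card_kernels_le:
  "finite V \<Longrightarrow> real (card (kernels V)) \<le> \<gamma> ^ card V"
proof (induction rule: finite_psubset_induct)
  case (psubset V)
  then interpret kernel_induction E V by unfold_locales auto
  show ?case by (rule bound)
qed

section \<open>Stable models as kernels\<close>

lemma P2_clause_cases:
  assumes "P \<in> P2 n" "c \<in> P"
  obtains a where "c = Definite a {}" | a b where "c = Definite a {Neg b}"
proof -
  have c: "is_definite c" "num_literals c \<le> 2" "purely_negative c" "finite (body c)"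
    using assms by (auto simp: P2_def logic_program_def)
  then obtain a B where aB: "c = Definite a B" by (cases c) auto
  then have "finite B" "card B \<le> 1" using c by auto
  then have "card B = 0 \<or> card B = 1" by linarith
  then consider "B = {}" | l where "B = {l}"
    using \<open>finite B\<close> card_0_eq by (blast elim: card_1_singletonE)
  then show thesis
  proof cases
    case (2 l)
    then show thesis using c(3) aB that by (cases l) (auto simp: purely_negative_def)
  qed (use aB that in auto)
qed

text \<open>The reduct consists of facts only, so its least model is the set of their heads.\<close>

lemma stable_model_iff:
  assumes P: "P \<in> P2 n" and M: "stable_model P M"
  shows "a \<in> M \<longleftrightarrow> Definite a {} \<in> P \<or> (\<exists>b. b \<notin> M \<and> Definite a {Neg b} \<in> P)"
proof -
  define H where "H = {a. Definite a {} \<in> P \<or> (\<exists>b. b \<notin> M \<and> Definite a {Neg b} \<in> P)}"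
  have "reduct P M = (\<lambda>a. Definite a {}) ` H"
  proof (rule set_eqI, rule iffI)
    fix c assume "c \<in> reduct P M"
    then obtain d where d: "d \<in> P" "\<not> (\<exists>a\<in>M. Neg a \<in> body d)" "c = delete_negated d"
      by (auto simp: reduct_def)
    show "c \<in> (\<lambda>a. Definite a {}) ` H"
      using P d(1)
    proof (rule P2_clause_cases)
      fix a b assume "d = Definite a {Neg b}"
      then show ?thesis using d by (auto simp: H_def)
    qed (use d in \<open>auto simp: H_def\<close>)
  next
    fix c assume "c \<in> (\<lambda>a. Definite a {}) ` H"
    then show "c \<in> reduct P M" by (force simp: H_def reduct_def image_iff)
  qed
  then have "model (reduct P M) N \<longleftrightarrow> H \<subseteq> N" for N by (auto simp: model_def)
  then have "M = H" using M by (auto simp: stable_model_def least_model_def)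
  then have "a \<in> M \<longleftrightarrow> a \<in> H" by simp
  then show ?thesis by (simp add: H_def)
qed

lemma card_stable_models_le:
  assumes P: "P \<in> P2 n"
  shows "real (card {M. stable_model P M}) \<le> \<gamma> ^ n"
proof -
  \<comment> \<open>Clauses \<open>a \<leftarrow> not(a)\<close> would be loops, which
    \<open>oriented_graph\<close> forbids; \<open>U\<close> accounts for them.\<close>
  define E where "E b a \<longleftrightarrow> a \<noteq> b \<and> Definite a {Neg b} \<in> P" for a b
  \<comment> \<open>The atoms left out belong to every stable model, so all false atoms lie in
    \<open>U\<close>.\<close>
  define U where "U = {a \<in> At P. Definite a {} \<notin> P \<and> Definite a {Neg a} \<notin> P}"
  interpret oriented_graph E
    using P by unfold_locales (auto simp: E_def P2_def has_dual_pair_def)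
  have fin: "finite (At P)" and card: "card (At P) = n"
    using P finite_At by (auto simp: P2_def)
  have At: "b \<in> At P" if "Definite a {Neg b} \<in> P" for a b
    using that by (force simp: At_def)
  have "card {M. stable_model P M} \<le> card (kernels U)"
  proof (rule card_inj_on_le)
    show "inj_on (\<lambda>M. At P - M) {M. stable_model P M}"
      by (rule inj_onI) (auto simp: stable_model_def)
    have "At P - M \<in> kernels U" if M: "stable_model P M" for M
    proof -
      have "a \<in> U" if "a \<in> At P - M" for a
        using stable_model_iff[OF P M, of a] that unfolding U_def by blast
      moreover have "a \<in> At P - M \<longleftrightarrow> \<not> (\<exists>b\<in>At P - M. E b a)" if "a \<in> U" for a
      proof -
        have "(\<exists>b\<in>At P - M. E b a) \<longleftrightarrow> (\<exists>b. b \<notin> M \<and> Definite a {Neg b} \<in> P)"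
          using that At[of a] unfolding U_def E_def
          by (metis (no_types, lifting) DiffD2 DiffI mem_Collect_eq)
        then show ?thesis
          using stable_model_iff[OF P M, of a] that unfolding U_def by blast
      qed
      ultimately show ?thesis unfolding kernels_def by blast
    qed
    then show "(\<lambda>M. At P - M) ` {M. stable_model P M} \<subseteq> kernels U" by blast
    show "finite (kernels U)" using fin by (intro finite_kernels) (simp add: U_def)
  qed
  also have "real (card (kernels U)) \<le> \<gamma> ^ card U"
    using fin by (intro card_kernels_le) (simp add: U_def)
  also have "\<dots> \<le> \<gamma> ^ card (At P)"
    using fin by (intro power_increasing card_mono) (auto simp: U_def)
  finally show ?thesis by (simp add: card)
qed

theorem theorem8:
  "\<exists>C::real. \<forall>n. \<forall>P \<in> (P2 n :: 'a clause set set).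
     real (card {M. stable_model P M}) \<le> C * 1.23651 ^ n"
  \<comment> \<open>The constant is 1: the empty graph has one kernel and the induction loses no
    factor.\<close>
  using card_stable_models_le by (intro exI[of _ 1]) auto

end
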